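(* Let $(X,d)$ be an $m$-space, let $K$ be a set (possibly infinite) with at least two elements, and let $(P_k)_{k\in K}$ be a tuple of nonempty subsets of $X$. Then there is a double zone diagram in $X$ with respect to $(P_k)_{k\in K}$. Furthermore, there are double zone diagrams $m$ and $M$ with respect to $(P_k)_{k\in K}$ such that $m\subseteq \mu\subseteq M$ for every double zone diagram $\mu$ with respect to $(P_k)_{k\in K}$, and they satisfy $m=\mathrm{Dom}(M)$ and $M=\mathrm{Dom}(m)$.
   Context: An $m$-space is a pair $(X,d)$ of a nonempty set $X$ and a function $d:X^2\to[-\infty,\infty]$ such that $d(x,x)\le d(x,y)$ for all $x,y\in X$ (no symmetry, positivity or triangle inequality is assumed). $\mathcal{P}^{*}(X)$ denotes the set of all nonempty subsets of $X$. For $x\in X$ and $A\in\mathcal{P}^{*}(X)$, $d(x,A)=\inf\{d(x,y):y\in A\}$. For $P,A\in\mathcal{P}^{*}(X)$, $\mathrm{dom}(P,A)=\{x\in X: d(x,P)\le d(x,A)\}$; it contains $P$, hence is nonempty. Given a tuple $(P_k)_{k\in K}$ of nonempty subsets of $X$, the mapping $\mathrm{Dom}$ from the set of all tuples $(R_k)_{k\in K}$ of nonempty subsets of $X$ to itself is defined by $\mathrm{Dom}(R)=\big(\mathrm{dom}(P_k,\bigcup_{j\ne k}R_j)\big)_{k\in K}$. A double zone diagram with respect to $(P_k)_{k\in K}$ is a fixed point of $\mathrm{Dom}^2=\mathrm{Dom}\circ\mathrm{Dom}$. Inclusion of tuples is component-wise: $R\subseteq S$ means $R_k\subseteq S_k$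 for all $k\in K$. *)

theory Defs
  imports "HOL-Library.Extended_Real" "HOL-Library.FuncSet"
begin

text \<open>Only the values of \<open>d\<close> on \<open>X \<times> X\<close> matter in what follows.\<close>

definition m_space :: "'a set \<Rightarrow> ('a \<Rightarrow> 'a \<Rightarrow> ereal) \<Rightarrow> bool" where
  "m_space X d \<longleftrightarrow> X \<noteq> {} \<and> (\<forall>x\<in>X. \<forall>y\<in>X. d x x \<le> d x y)"

definition Pstar :: "'a set \<Rightarrow> 'a set set" where
  "Pstar X = Pow X - {{}}"

definition pt_set_dist :: "('a \<Rightarrow> 'a \<Rightarrow> ereal) \<Rightarrow> 'a \<Rightarrow> 'a set \<Rightarrow> ereal" where
  "pt_set_dist d x A = (INF y\<in>A. d x y)"

definition dom_region :: "'a set \<Rightarrow> ('a \<Rightarrow> 'a \<Rightarrow> ereal) \<Rightarrow> 'a set \<Rightarrow> 'a set \<Rightarrow> 'a set" where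
  "dom_region X d P A = {x \<in> X. pt_set_dist d x P \<le> pt_set_dist d x A}"

text \<open>Tuples indexed by \<open>K\<close> are extensional functions, i.e. they have the value \<open>undefined\<close>
  outside \<open>K\<close>, so that HOL equality of tuples is component-wise equality on \<open>K\<close>.\<close>

definition tuples :: "'k set \<Rightarrow> 'a set \<Rightarrow> ('k \<Rightarrow> 'a set) set" where
  "tuples K X = K \<rightarrow>\<^sub>E Pstar X"

definition tuple_le :: "'k set \<Rightarrow> ('k \<Rightarrow> 'a set) \<Rightarrow> ('k \<Rightarrow> 'a set) \<Rightarrow> bool" where
  "tuple_le K R S \<longleftrightarrow> (\<forall>k\<in>K. R k \<subseteq> S k)"

definition Dom :: "'a set \<Rightarrow> ('a \<Rightarrow> 'a \<Rightarrow> ereal) \<Rightarrow> 'k set \<Rightarrow> ('k \<Rightarrow> 'a set)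
    \<Rightarrow> ('k \<Rightarrow> 'a set) \<Rightarrow> ('k \<Rightarrow> 'a set)" where
  "Dom X d K P R = (\<lambda>k\<in>K. dom_region X d (P k) (\<Union>j\<in>K - {k}. R j))"

definition double_zone_diagram :: "'a set \<Rightarrow> ('a \<Rightarrow> 'a \<Rightarrow> ereal) \<Rightarrow> 'k set \<Rightarrow> ('k \<Rightarrow> 'a set)
    \<Rightarrow> ('k \<Rightarrow> 'a set) \<Rightarrow> bool" where
  "double_zone_diagram X d K P R \<longleftrightarrow>
     R \<in> tuples K X \<and> (Dom X d K P \<circ> Dom X d K P) R = R"

lemma dom_region_superset:
  assumes "m_space X d" and "P \<subseteq> X" and "A \<subseteq> X"
  shows "P \<subseteq> dom_region X d P A"
proof
  fix x assume x: "x \<in> P"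
  have "pt_set_dist d x P \<le> d x x"
    unfolding pt_set_dist_def by (rule INF_lower[OF x])
  also have "d x x \<le> pt_set_dist d x A"
    unfolding pt_set_dist_def using assms x
    by (intro INF_greatest) (auto simp: m_space_def)
  finally show "x \<in> dom_region X d P A"
    using x assms by (auto simp: dom_region_def)
qed

lemma Dom_in_tuples:
  assumes "m_space X d" and "P \<in> tuples K X" and "R \<in> tuples K X"
  shows "Dom X d K P R \<in> tuples K X"
  unfolding tuples_def
proof (rule PiE_I)
  fix k assume k: "k \<in> K"
  have Pk: "P k \<subseteq> X" "P k \<noteq> {}"
    using assms(2) k by (auto simp: tuples_def Pstar_def PiE_def Pi_def)
  have "(\<Union>j\<in>K - {k}. R j) \<subseteq> X"
    using assms(3) by (auto simp: tuples_def Pstar_def PiE_def Pi_def)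
  from dom_region_superset[OF assms(1) Pk(1) this] Pk(2)
  show "Dom X d K P R k \<in> Pstar X"
    using k by (auto simp: Dom_def Pstar_def dom_region_def)
qed (simp add: Dom_def)

end

theory Submission
  imports Defs
begin

text \<open>\<open>Dom\<close> reverses inclusion (\<open>Dom_antimono\<close>) and its value at any tuple contains the tuple of sites \<open>P\<close>
  (\<open>P_le_Dom\<close>), so \<open>Dom\<^sup>2\<close> is an increasing self-map of the tuples.  As in the
  Knaster--Tarski theorem, the component-wise intersection of all tuples \<open>R\<close> with
  \<open>Dom\<^sup>2 R \<subseteq> R\<close> is then its least fixed point \<open>m\<close>; the components of this intersection
  are nonempty because \<open>P \<subseteq> Dom\<^sup>2 R \<subseteq> R\<close> for every such \<open>R\<close>.

  Since \<open>Dom\<close> maps double zone diagrams to double zone diagrams and reverses inclusion, the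
  greatest one is \<open>M = Dom m\<close>: from \<open>m \<subseteq> Dom \<mu>\<close> follows \<open>\<mu> = Dom\<^sup>2 \<mu> \<subseteq> Dom m\<close>.
  Finally \<open>Dom M = Dom\<^sup>2 m = m\<close>.\<close>

lemma tuple_le_antisym:
  assumes "R \<in> tuples K X" "S \<in> tuples K X" "tuple_le K R S" "tuple_le K S R"
  shows "R = S"
  using assms by (intro PiE_ext[of _ K "\<lambda>_. Pstar X"]) (auto simp: tuples_def tuple_le_def)

lemma tuple_le_trans: "tuple_le K R S \<Longrightarrow> tuple_le K S T \<Longrightarrow> tuple_le K R T"
  unfolding tuple_le_def by blast

lemma dom_region_antimono: "A \<subseteq> B \<Longrightarrow> dom_region X d P B \<subseteq> dom_region X d P A"
  by (auto simp: dom_region_def pt_set_dist_def intro: order_trans INF_superset_mono)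

lemma Dom_antimono:
  assumes "tuple_le K R S"
  shows "tuple_le K (Dom X d K P S) (Dom X d K P R)"
  unfolding tuple_le_def
proof
  fix k assume "k \<in> K"
  moreover have "(\<Union>j\<in>K - {k}. R j) \<subseteq> (\<Union>j\<in>K - {k}. S j)"
    using assms by (auto simp: tuple_le_def)
  ultimately show "Dom X d K P S k \<subseteq> Dom X d K P R k"
    by (simp add: Dom_def dom_region_antimono)
qed

lemma P_le_Dom:
  assumes "m_space X d" "P \<in> tuples K X" "R \<in> tuples K X"
  shows "tuple_le K P (Dom X d K P R)"
  unfolding tuple_le_def
proof
  fix k assume k: "k \<in> K"
  have "P k \<subseteq> X" "(\<Union>j\<in>K - {k}. R j) \<subseteq> X"
    using assms k by (auto simp: tuples_def Pstar_def PiE_def Pi_def)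
  then show "P k \<subseteq> Dom X d K P R k"
    using dom_region_superset[OF assms(1)] k by (simp add: Dom_def)
qed

lemma double_zone_diagram_Dom:
  assumes "m_space X d" "P \<in> tuples K X" "double_zone_diagram X d K P R"
  shows "double_zone_diagram X d K P (Dom X d K P R)"
  using assms Dom_in_tuples by (fastforce simp: double_zone_diagram_def)

lemma least_double_zone_diagram:
  assumes X: "m_space X d" and P: "P \<in> tuples K X"
  obtains m where "double_zone_diagram X d K P m"
    and "\<And>\<mu>. double_zone_diagram X d K P \<mu> \<Longrightarrow> tuple_le K m \<mu>"
proof -
  define F where "F R = Dom X d K P (Dom X d K P R)" for R
  define \<R> where "\<R> = {R \<in> tuples K X. tuple_le K (F R) R}"
  define m where "m = (\<lambda>k\<in>K. \<Inter>R\<in>\<R>. R k)"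
  have F_tuples: "F R \<in> tuples K X" if "R \<in> tuples K X" for R
    unfolding F_def using Dom_in_tuples[OF X P] that by blast
  have F_mono: "tuple_le K (F R) (F S)" if "tuple_le K R S" for R S
    unfolding F_def by (intro Dom_antimono that)
  have P_le: "tuple_le K P R" if "R \<in> \<R>" for R
    using P_le_Dom[OF X P] Dom_in_tuples[OF X P] that tuple_le_trans
    unfolding \<R>_def F_def by blast
  have lower: "tuple_le K m R" if "R \<in> \<R>" for R
    using that by (auto simp: m_def tuple_le_def)
  \<comment> \<open>The family is nonempty, so the intersection stays inside \<open>X\<close>.\<close>
  have top: "(\<lambda>k\<in>K. X) \<in> \<R>"
  proof -
    have t: "(\<lambda>k\<in>K. X) \<in> tuples K X"
      using X by (auto simp: tuples_def Pstar_def m_space_def)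
    moreover have "tuple_le K (F (\<lambda>k\<in>K. X)) (\<lambda>k\<in>K. X)"
      using F_tuples[OF t] by (auto simp: tuple_le_def tuples_def Pstar_def PiE_def Pi_def)
    ultimately show ?thesis by (simp add: \<R>_def)
  qed
  have m: "m \<in> tuples K X"
    unfolding tuples_def
  proof (rule PiE_I)
    fix k assume k: "k \<in> K"
    have "P k \<subseteq> m k"
      using P_le k by (auto simp: m_def tuple_le_def)
    moreover have "P k \<noteq> {}"
      using P k by (auto simp: tuples_def Pstar_def PiE_def Pi_def)
    moreover have "m k \<subseteq> X"
      using lower[OF top] k by (auto simp: tuple_le_def)
    ultimately show "m k \<in> Pstar X" by (auto simp: Pstar_def)
  qed (simp add: m_def)
  have "tuple_le K (F m) R" if "R \<in> \<R>" for R
    using F_mono[OF lower[OF that]] that tuple_le_trans by (auto simp: \<R>_def)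
  then have pre: "tuple_le K (F m) m"
    by (auto simp: m_def tuple_le_def)
  have "F m \<in> \<R>"
    using F_tuples[OF m] F_mono[OF pre] by (simp add: \<R>_def)
  then have "F m = m"
    using tuple_le_antisym[OF F_tuples[OF m] m pre] lower by blast
  then have "double_zone_diagram X d K P m"
    using m by (simp add: double_zone_diagram_def F_def)
  moreover have "tuple_le K m \<mu>" if "double_zone_diagram X d K P \<mu>" for \<mu>
    using that
    by (intro lower) (auto simp: \<R>_def F_def double_zone_diagram_def tuple_le_def)
  ultimately show thesis by (rule that)
qed

theorem theorem5p5:
  fixes X :: "'a set" and d :: "'a \<Rightarrow> 'a \<Rightarrow> ereal"
    and K :: "'k set" and P :: "'k \<Rightarrow> 'a set"
  assumes "m_space X d"
    and "\<exists>i\<in>K. \<exists>j\<in>K. i \<noteq> j"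
    and "P \<in> tuples K X"
  shows "(\<exists>\<mu>. double_zone_diagram X d K P \<mu>) \<and>
    (\<exists>m M. double_zone_diagram X d K P m \<and> double_zone_diagram X d K P M \<and>
       (\<forall>\<mu>. double_zone_diagram X d K P \<mu> \<longrightarrow> tuple_le K m \<mu> \<and> tuple_le K \<mu> M) \<and>
       m = Dom X d K P M \<and> M = Dom X d K P m)"
proof -
  obtain m where m: "double_zone_diagram X d K P m"
    and least: "\<And>\<mu>. double_zone_diagram X d K P \<mu> \<Longrightarrow> tuple_le K m \<mu>"
    using least_double_zone_diagram[OF assms(1,3)] by blast
  define M where "M = Dom X d K P m"
  have M: "double_zone_diagram X d K P M"
    unfolding M_def by (rule double_zone_diagram_Dom[OF assms(1,3) m])
  have greatest: "tuple_le K \<mu> M" if \<mu>: "double_zone_diagram X d K P \<mu>" for \<mu>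
  proof -
    have "tuple_le K m (Dom X d K P \<mu>)"
      by (intro least double_zone_diagram_Dom[OF assms(1,3)] \<mu>)
    then have "tuple_le K (Dom X d K P (Dom X d K P \<mu>)) M"
      unfolding M_def by (rule Dom_antimono)
    then show ?thesis using \<mu> by (simp add: double_zone_diagram_def)
  qed
  have "m = Dom X d K P M"
    using m by (simp add: M_def double_zone_diagram_def)
  then show ?thesis using m M least greatest M_def by blast
qed

end
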